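(* For each integer $g\ge 1$ let $\gamma_g = |\mathcal G(g)|/2^{g-1}$, where $\mathcal G(g)$ is the set of numerical sets $S$ with Frobenius number $g$ whose atom monoid is $A(S)=\{0\}\cup(g,\infty)$ (the total number of numerical sets with Frobenius number $g$ being $2^{g-1}$). Then the sequence $(\gamma_g)_{g\ge1}$ is (weakly) decreasing and converges to a real number $\gamma_\infty$ satisfying $|\gamma_\infty - 0.484451|\le 0.005011$.
   Context: All intervals are intervals of integers. A numerical set is a cofinite subset $S\subseteq\mathbb N=\{0,1,2,\dots\}$ containing $0$; for $S \neq \mathbb N$ its Frobenius number is $\max(\mathbb N - S)$. The atom monoid of $S$ is $A(S)=\{n\in\mathbb Z : n+S\subseteq S\}$, where $n+S=\{n+s: s\in S\}$. *)

theory Defs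
  imports Complex_Main
begin

definition numerical_set :: "nat set \<Rightarrow> bool" where
  "numerical_set S \<longleftrightarrow> finite (UNIV - S) \<and> 0 \<in> S"

(* Only meaningful for a numerical set S other than UNIV: Max {} is unspecified. *)
definition frobenius_number :: "nat set \<Rightarrow> nat" where
  "frobenius_number S = Max (UNIV - S)"

(* The translates n range over all integers, hence the embedding of S into int. *)
definition atom_monoid :: "nat set \<Rightarrow> int set" where
  "atom_monoid S = {n. (\<lambda>s. n + s) ` (int ` S) \<subseteq> int ` S}"

definition numerical_sets_with_frobenius :: "nat \<Rightarrow> nat set set" where
  "numerical_sets_with_frobenius g =
     {S. numerical_set S \<and> S \<noteq> UNIV \<and> frobenius_number S = g}"

definition no_small_atoms :: "nat \<Rightarrow> nat set set" where
  "no_small_atoms g =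
     {S \<in> numerical_sets_with_frobenius g. atom_monoid S = {0} \<union> {int g<..}}"

(* Used for g \<ge> 1 only; the subtraction truncates at g = 0. *)
definition gamma_ratio :: "nat \<Rightarrow> real" where
  "gamma_ratio g = real (card (no_small_atoms g)) / 2 ^ (g - 1)"

end

theory Submission
  imports Defs
begin

text \<open>
  Put \<open>h = (g - 1) div 2\<close>. Only the possible atoms \<open>g - k\<close> with \<open>0 < k \<le> h\<close> matter, and whether \<open>g - k\<close>
  is an atom depends on \<open>A = S \<inter> {..h}\<close> and \<open>B = {i\<le>h. g - i \<notin> S}\<close> alone: it is not one iff
  \<open>k \<in> A + B\<close>. So \<open>\<gamma>\<^sub>g\<close> is the proportion \<open>c\<^sub>h\<close> of the pairs \<open>A, B \<subseteq> {0..h}\<close> containing \<open>0\<close> for which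
  \<open>A + B\<close> covers \<open>{0..h}\<close>. Restriction to \<open>{0..h}\<close> shows that \<open>c\<close> decreases. If \<open>h + 1 \<notin> A + B\<close>, then \<open>A\<close>
  and the reflection of \<open>B\<close> are disjoint on \<open>{1..h}\<close>, which allows \<open>3\<^sup>h\<close> pairs, so
  \<open>c\<^sub>h - (3/4)\<^sup>h\<close> increases. Hence the limit lies between \<open>c\<^sub>1\<^sub>7 - (3/4)\<^sup>1\<^sup>7\<close> and \<open>c\<^sub>1\<^sub>7\<close>.

  To estimate \<open>c\<^sub>1\<^sub>7\<close>, all prefixes \<open>A \<inter> {0..8}, B \<inter> {0..8}\<close> are enumerated. For a fixed prefix and
  \<open>9 \<le> k \<le> 17\<close>, the condition \<open>k \<notin> A + B\<close> is either impossible or says that certain positions beyond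
  the prefix are empty, because \<open>i\<close> or \<open>k - i\<close> is at most \<open>8\<close>. These events and their pairwise intersections
  are counted by powers of two; their union is estimated by the union bound from above and by
  Bonferroni's inequality, applied one event at a time, from below.
\<close>

section \<open>Reduction to pairs of sets\<close>

definition covering_pairs :: "nat \<Rightarrow> (nat set \<times> nat set) set" where
  "covering_pairs h = {(A, B). A \<subseteq> {..h} \<and> B \<subseteq> {..h} \<and> 0 \<in> A \<and> 0 \<in> B \<and>
     (\<forall>k\<le>h. \<exists>i\<le>k. i \<in> A \<and> k - i \<in> B)}"

definition covering_ratio :: "nat \<Rightarrow> real" where
  "covering_ratio h = real (card (covering_pairs h)) / 4 ^ h"

lemma finite_covering_pairs: "finite (covering_pairs h)"
proof -
  have "covering_pairs h \<subseteq> Pow {..h} \<times> Pow {..h}"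
    by (auto simp: covering_pairs_def)
  then show ?thesis by (rule finite_subset) auto
qed

lemma numerical_sets_with_frobenius_iff:
  "S \<in> numerical_sets_with_frobenius g \<longleftrightarrow> 0 \<in> S \<and> g \<notin> S \<and> {g<..} \<subseteq> S"
proof
  assume "S \<in> numerical_sets_with_frobenius g"
  then have fin: "finite (UNIV - S)" and 0: "0 \<in> S" and ne: "UNIV - S \<noteq> {}" and g: "Max (UNIV - S) = g"
    by (auto simp: numerical_sets_with_frobenius_def numerical_set_def frobenius_number_def)
  have "g \<notin> S" using Max_in[OF fin ne] g by auto
  moreover have "x \<in> S" if "g < x" for x
    using Max_ge[OF fin, of x] g that by force
  ultimately show "0 \<in> S \<and> g \<notin> S \<and> {g<..} \<subseteq> S" using 0 by auto
next
  assume S: "0 \<in> S \<and> g \<notin> S \<and> {g<..} \<subseteq> S"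
  have sub: "UNIV - S \<subseteq> {..g}" using S by (auto simp: not_le)
  then have fin: "finite (UNIV - S)" by (rule finite_subset) simp
  have "Max (UNIV - S) = g"
    using S sub by (intro Max_eqI fin) auto
  then show "S \<in> numerical_sets_with_frobenius g"
    using S fin by (auto simp: numerical_sets_with_frobenius_def numerical_set_def frobenius_number_def)
qed

text \<open>The elements \<open>1\<close>, ..., \<open>g - 1\<close> are free; membership of every
  other number is forced.\<close>

lemma card_numerical_sets_with_frobenius:
  assumes "g \<ge> 1"
  shows "card (numerical_sets_with_frobenius g) = 2 ^ (g - 1)"
proof -
  have "bij_betw (\<lambda>T. insert 0 T \<union> {g<..}) (Pow {1..<g}) (numerical_sets_with_frobenius g)"
  proof (rule bij_betw_byWitness[where f' = "\<lambda>S. S \<inter> {1..<g}"])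
    show "\<forall>S\<in>numerical_sets_with_frobenius g. insert 0 (S \<inter> {1..<g}) \<union> {g<..} = S"
    proof (intro ballI set_eqI)
      fix S x assume "S \<in> numerical_sets_with_frobenius g"
      then have "0 \<in> S" "g \<notin> S" "{g<..} \<subseteq> S" by (auto simp: numerical_sets_with_frobenius_iff)
      then show "x \<in> insert 0 (S \<inter> {1..<g}) \<union> {g<..} \<longleftrightarrow> x \<in> S"
        by (cases "x = 0"; cases "x = g"; cases "x < g") auto
    qed
  qed (use assms in \<open>auto simp: numerical_sets_with_frobenius_iff\<close>)
  then show ?thesis by (simp add: bij_betw_same_card[symmetric] card_Pow)
qed

lemma nat_mem_atom_monoid_iff: "int n \<in> atom_monoid S \<longleftrightarrow> (\<forall>s\<in>S. n + s \<in> S)"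
proof -
  have "int n \<in> atom_monoid S \<longleftrightarrow> (\<forall>s\<in>S. int (n + s) \<in> int ` S)"
    by (auto simp: atom_monoid_def)
  then show ?thesis by (simp add: inj_image_mem_iff del: of_nat_add)
qed

text \<open>Since \<open>0\<close> lies in \<open>S\<close>, every atom lies in \<open>S\<close> and
  is nonnegative. All \<open>n > g\<close> are atoms, and \<open>g\<close> is not, because it moves
  \<open>0\<close> out of \<open>S\<close>. Only \<open>0 < n < g\<close> is left to decide.\<close>

lemma no_small_atoms_iff:
  "S \<in> no_small_atoms g \<longleftrightarrow> S \<in> numerical_sets_with_frobenius g \<and>
     (\<forall>n. 0 < n \<and> n < g \<longrightarrow> (\<exists>s\<in>S. n + s \<notin> S))"
proof (cases "S \<in> numerical_sets_with_frobenius g")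
  case True
  then have S: "0 \<in> S" "g \<notin> S" "{g<..} \<subseteq> S" by (auto simp: numerical_sets_with_frobenius_iff)
  have neg: "m \<ge> 0" if "m \<in> atom_monoid S" for m :: int
  proof -
    have "m + int 0 \<in> int ` S" using that S(1) unfolding atom_monoid_def by blast
    then show ?thesis by auto
  qed
  have gpos: "0 < g" using S(1,2) by (metis gr0I)
  have big: "int n \<in> atom_monoid S" if "g < n" for n
    using S that by (auto simp: nat_mem_atom_monoid_iff)
  have zero: "int 0 \<in> atom_monoid S" by (subst nat_mem_atom_monoid_iff) auto
  have Frob: "int g \<notin> atom_monoid S" using S(1,2) by (metis add_0_right nat_mem_atom_monoid_iff)
  have "atom_monoid S = {0} \<union> {int g<..} \<longleftrightarrow> (\<forall>n. 0 < n \<and> n < g \<longrightarrow> int n \<notin> atom_monoid S)"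
  proof (intro iffI allI impI)
    fix n assume "atom_monoid S = {0} \<union> {int g<..}" "0 < n \<and> n < g"
    then show "int n \<notin> atom_monoid S" by auto
  next
    assume R: "\<forall>n. 0 < n \<and> n < g \<longrightarrow> int n \<notin> atom_monoid S"
    show "atom_monoid S = {0} \<union> {int g<..}"
    proof (intro set_eqI)
      fix m :: int
      show "m \<in> atom_monoid S \<longleftrightarrow> m \<in> {0} \<union> {int g<..}"
      proof (cases "m \<ge> 0")
        case True
        then obtain n where n: "m = int n" using nonneg_int_cases by blast
        consider "n = 0" | "0 < n \<and> n < g" | "n = g" | "g < n" by linarith
        then show ?thesis
          using R big[of n] zero Frob n gpos by cases auto
      next
        case False
        then show ?thesis using neg[of m] by auto
      qed
    qed
  qed
  then show ?thesis using True by (auto simp: no_small_atoms_def nat_mem_atom_monoid_iff)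
qed (simp add: no_small_atoms_def)

text \<open>Multiples of an atom are atoms, and an atom never divides the Frobenius number; hence
  a set with a small atom has one in the upper half of \<open>{0<..<g}\<close>.\<close>

lemma no_small_atoms_iff_upper_half:
  "S \<in> no_small_atoms g \<longleftrightarrow> S \<in> numerical_sets_with_frobenius g \<and>
     (\<forall>k. 0 < k \<and> 2 * k < g \<longrightarrow> (\<exists>s\<in>S. g - k + s \<notin> S))"
proof (intro iffI conjI allI impI)
  fix k assume S: "S \<in> no_small_atoms g" and k: "0 < k \<and> 2 * k < g"
  then have "0 < g - k \<and> g - k < g" by auto
  with S show "\<exists>s\<in>S. g - k + s \<notin> S" unfolding no_small_atoms_iff by blast
next
  assume R: "S \<in> numerical_sets_with_frobenius g \<and>
     (\<forall>k. 0 < k \<and> 2 * k < g \<longrightarrow> (\<exists>s\<in>S. g - k + s \<notin> S))"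
  then have S: "0 \<in> S" "g \<notin> S" by (auto simp: numerical_sets_with_frobenius_iff)
  have False if n: "0 < n" "n < g" and atom: "\<forall>s\<in>S. n + s \<in> S" for n
  proof -
    have mult: "\<forall>s\<in>S. m * n + s \<in> S" for m
      using atom by (induction m) (auto simp: add.assoc)
    have nd: "g mod n \<noteq> 0"
    proof
      assume "g mod n = 0"
      then have "g = (g div n) * n + 0" by auto
      then show False using mult[of "g div n"] S by metis
    qed
    \<comment> \<open>\<open>g - k\<close> is the largest multiple of \<open>n\<close> up to
      \<open>g\<close>. It is at least \<open>n\<close>, hence larger than \<open>k\<close>, so
      \<open>2 * k < g\<close>; being a multiple of the atom \<open>n\<close>, it contradicts the
      assumption for \<open>k\<close>.\<close>
    define k where "k = g mod n"
    have gk: "g - k = (g div n) * n" by (simp add: k_def minus_mod_eq_div_mult)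
    have "g div n \<ge> 1" using n by (simp add: Suc_leI div_greater_zero_iff)
    then have "n \<le> g - k" unfolding gk by simp
    moreover have "k < n" using n by (simp add: k_def)
    ultimately have "0 < k \<and> 2 * k < g" using nd k_def by simp
    then obtain s where "s \<in> S" "g - k + s \<notin> S" using R by blast
    then show False using mult[of "g div n"] gk by auto
  qed
  then show "S \<in> no_small_atoms g" unfolding no_small_atoms_iff using R by blast
qed (auto simp: no_small_atoms_iff)

text \<open>The lower bits of \<open>S\<close> give \<open>A\<close>, the complemented reflected upper bits give \<open>B\<close>:
  then \<open>g - k\<close> is not an atom iff \<open>k \<in> A + B\<close>. The middle bit, if any, is free.\<close>

lemma card_no_small_atoms:
  assumes g: "g \<ge> 1" and h: "h = (g - 1) div 2"
  shows "card (no_small_atoms g) = card (covering_pairs h) * 2 ^ (g - 1 - 2 * h)"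
proof -
  \<comment> \<open>\<open>M\<close> is empty for odd \<open>g\<close> and \<open>{h + 1}\<close>
    for even \<open>g\<close>.\<close>
  define M where "M = {h<..<g - h}"
  have cM: "card M = g - 1 - 2 * h" unfolding M_def by simp
  have hg: "2 * h < g" using g h by linarith
  have half: "2 * k < g \<longleftrightarrow> k \<le> h" for k using g h by linarith
  define F where "F = (\<lambda>S::nat set. ((S \<inter> {..h}, {i\<in>{..h}. g - i \<notin> S}), S \<inter> M))"
  define G where "G = (\<lambda>((A, B), C). A \<union> C \<union> {x\<in>{g-h..g}. g - x \<notin> B} \<union> {g<..})"
  have mem: "S \<in> no_small_atoms g \<longleftrightarrow> 0 \<in> S \<and> g \<notin> S \<and> {g<..} \<subseteq> S \<and>
      (\<forall>k\<le>h. \<exists>i\<le>k. i \<in> S \<and> g - (k - i) \<notin> S)" for S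
  proof -
    \<comment> \<open>A shift by \<open>s > k\<close> passes \<open>g\<close> and lands in
      \<open>S\<close>, so every witness satisfies \<open>s \<le> k\<close>.\<close>
    have "(\<exists>s\<in>S. g - k + s \<notin> S) \<longleftrightarrow> (\<exists>i\<le>k. i \<in> S \<and> g - (k - i) \<notin> S)"
      if S: "{g<..} \<subseteq> S" and k: "k \<le> h" for k
    proof
      assume "\<exists>s\<in>S. g - k + s \<notin> S"
      then obtain s where s: "s \<in> S" "g - k + s \<notin> S" by blast
      then have "\<not> g < g - k + s" using S by blast
      then have "s \<le> k" "g - k + s = g - (k - s)" using k hg by linarith+
      then show "\<exists>i\<le>k. i \<in> S \<and> g - (k - i) \<notin> S" using s by metis
    next
      assume "\<exists>i\<le>k. i \<in> S \<and> g - (k - i) \<notin> S"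
      then obtain i where i: "i \<le> k" "i \<in> S" "g - (k - i) \<notin> S" by blast
      then have "g - (k - i) = g - k + i" using k hg by linarith
      then show "\<exists>s\<in>S. g - k + s \<notin> S" using i by metis
    qed
    then have "S \<in> no_small_atoms g \<longleftrightarrow> 0 \<in> S \<and> g \<notin> S \<and> {g<..} \<subseteq> S \<and>
        (\<forall>k. 0 < k \<and> k \<le> h \<longrightarrow> (\<exists>i\<le>k. i \<in> S \<and> g - (k - i) \<notin> S))"
      unfolding no_small_atoms_iff_upper_half numerical_sets_with_frobenius_iff half by blast
    \<comment> \<open>The position \<open>k = 0\<close> is always covered, so the range can start at
      \<open>0\<close> as in \<open>covering_pairs\<close>.\<close>
    moreover have "\<exists>i\<le>0. i \<in> S \<and> g - (0 - i) \<notin> S" if "0 \<in> S" "g \<notin> S" using that by simp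
    ultimately show ?thesis by (metis gr0I)
  qed
  have G_low: "x \<in> G ((A, B), C) \<longleftrightarrow> x \<in> A" if "C \<subseteq> M" "x \<le> h" for A B C x
    using that hg unfolding G_def M_def by auto
  have G_mid: "x \<in> G ((A, B), C) \<longleftrightarrow> x \<in> C" if "A \<subseteq> {..h}" "x \<in> M" for A B C x
    using that unfolding G_def M_def by auto
  have G_high: "g - i \<in> G ((A, B), C) \<longleftrightarrow> i \<notin> B" if "A \<subseteq> {..h}" "C \<subseteq> M" "i \<le> h" for A B C i
  proof -
    have "g - i \<notin> A" "g - i \<notin> C" "g - h \<le> g - i" "\<not> g < g - i" "g - (g - i) = i"
      using that hg unfolding M_def by force+
    then show ?thesis by (simp add: G_def)
  qed
  have "bij_betw F (no_small_atoms g) (covering_pairs h \<times> Pow M)"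
  proof (rule bij_betw_byWitness[where f' = G])
    show "\<forall>S\<in>no_small_atoms g. G (F S) = S"
    proof (intro ballI set_eqI)
      fix S x assume "S \<in> no_small_atoms g"
      then have S: "{g<..} \<subseteq> S" by (simp add: mem)
      have FS: "F S = ((S \<inter> {..h}, {i\<in>{..h}. g - i \<notin> S}), S \<inter> M)" by (simp add: F_def)
      consider "x \<le> h" | "x \<in> M" | "h < x" "x \<notin> M" "x \<le> g" | "g < x"
        by linarith
      then show "x \<in> G (F S) \<longleftrightarrow> x \<in> S"
      proof cases
        case 1
        then show ?thesis unfolding FS by (subst G_low) auto
      next
        case 2
        then show ?thesis unfolding FS by (subst G_mid) auto
      next
        case 3
        then have i: "g - x \<le> h" "g - (g - x) = x" unfolding M_def by auto
        then show ?thesis unfolding FS using G_high[of "S \<inter> {..h}" "S \<inter> M" "g - x"] by auto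
      next
        case 4
        then show ?thesis using S by (auto simp: G_def FS)
      qed
    qed
    show "\<forall>p\<in>covering_pairs h \<times> Pow M. F (G p) = p"
    proof
      fix p assume p: "p \<in> covering_pairs h \<times> Pow M"
      obtain A B C where pe: "p = ((A, B), C)" by (cases p) auto
      have AB: "A \<subseteq> {..h}" "B \<subseteq> {..h}" "C \<subseteq> M"
        using p by (auto simp: pe covering_pairs_def)
      have "G p \<inter> {..h} = A"
        using AB G_low[of C _ A B] by (auto simp: pe)
      moreover have "{i\<in>{..h}. g - i \<notin> G p} = B"
        using AB G_high[of A C _ B] by (auto simp: pe)
      moreover have "G p \<inter> M = C"
        using AB G_mid[of A _ B C] by (auto simp: pe)
      ultimately show "F (G p) = p" by (simp add: F_def pe)
    qed
    show "F ` no_small_atoms g \<subseteq> covering_pairs h \<times> Pow M"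
      by (fastforce simp: mem F_def covering_pairs_def)
    show "G ` (covering_pairs h \<times> Pow M) \<subseteq> no_small_atoms g"
    proof safe
      fix A B C assume p: "(A, B) \<in> covering_pairs h" and C: "C \<subseteq> M"
      define S where "S = G ((A, B), C)"
      have AB: "A \<subseteq> {..h}" "B \<subseteq> {..h}" "0 \<in> A" "0 \<in> B" "\<forall>k\<le>h. \<exists>i\<le>k. i \<in> A \<and> k - i \<in> B"
        using p by (auto simp: covering_pairs_def)
      have lo: "i \<in> A \<Longrightarrow> i \<in> S" for i by (simp add: S_def G_def)
      have hi: "g - i \<notin> S" if "i \<in> B" for i
        using AB(1,2) C that G_high[of A C i B] by (auto simp: S_def)
      have "0 \<in> S" "g \<notin> S" "{g<..} \<subseteq> S"
        using lo[of 0] hi[of 0] AB(3,4) by (auto simp: S_def G_def)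
      moreover have "\<forall>k\<le>h. \<exists>i\<le>k. i \<in> S \<and> g - (k - i) \<notin> S"
        using AB(5) lo hi by blast
      ultimately have "S \<in> no_small_atoms g" by (simp add: mem)
      then show "G ((A, B), C) \<in> no_small_atoms g" by (simp add: S_def)
    qed
  qed
  moreover have "finite M" by (simp add: M_def)
  ultimately show ?thesis
    by (simp add: bij_betw_same_card card_cartesian_product card_Pow cM)
qed

text \<open>The factor for the free middle bit cancels against the denominator, so the ratios at
  \<open>2 * h + 1\<close> and \<open>2 * h + 2\<close> agree.\<close>

lemma gamma_ratio_eq_covering_ratio:
  assumes "g \<ge> 1"
  shows "gamma_ratio g = covering_ratio ((g - 1) div 2)"
proof -
  define h where "h = (g - 1) div 2"
  have split: "g - 1 = (g - 1 - 2 * h) + 2 * h" by (simp add: h_def)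
  have "(2::real) ^ (g - 1) = 2 ^ (g - 1 - 2 * h) * 2 ^ (2 * h)"
    by (metis split power_add)
  also have "(2::real) ^ (2 * h) = 4 ^ h" by (simp add: power_mult)
  finally show ?thesis
    using card_no_small_atoms[OF assms h_def]
    by (simp add: gamma_ratio_def covering_ratio_def del: One_nat_def flip: h_def)
qed

section \<open>The recursive step\<close>

text \<open>Each element has three choices: only in \<open>X\<close>, only in \<open>Y\<close>, or
  in neither.\<close>

lemma card_disjoint_subset_pairs:
  assumes "finite U"
  shows "card {(X, Y). X \<subseteq> U \<and> Y \<subseteq> U \<and> X \<inter> Y = {}} = 3 ^ card U"
  using assms
proof (induction U rule: finite_induct)
  case empty
  have "{(X, Y). X \<subseteq> {} \<and> Y \<subseteq> {} \<and> X \<inter> Y = {}} = {({}::'a set, {}::'a set)}" by auto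
  then show ?case by simp
next
  case (insert u U)
  define D where "D V = {(X, Y). X \<subseteq> V \<and> Y \<subseteq> V \<and> X \<inter> Y = {}}" for V :: "'a set"
  let ?fX = "\<lambda>(X, Y). (insert u X, Y)" and ?fY = "\<lambda>(X, Y). (X, insert u Y)"
  have fin: "finite (D U)"
    by (rule finite_subset[of _ "Pow U \<times> Pow U"]) (use insert in \<open>auto simp: D_def\<close>)
  have "D (insert u U) = D U \<union> (?fX ` D U \<union> ?fY ` D U)" (is "?L = ?R")
  proof
    show "?L \<subseteq> ?R"
    proof (rule subsetI, rule ccontr)
      fix p assume p: "p \<in> D (insert u U)" "p \<notin> D U \<union> (?fX ` D U \<union> ?fY ` D U)"
      obtain X Y where XY: "p = (X, Y)" by (cases p)
      have D: "(X, Y) \<in> D (insert u U)" using p XY by simp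
      have *: "(X, Y) \<notin> D U" "(X, Y) \<notin> ?fX ` D U" "(X, Y) \<notin> ?fY ` D U" using p XY by blast+
      have "u \<notin> X"
      proof
        assume "u \<in> X"
        then have "(X - {u}, Y) \<in> D U" "(X, Y) = ?fX (X - {u}, Y)" using D by (auto simp: D_def)
        then show False using * by blast
      qed
      moreover have "u \<notin> Y"
      proof
        assume "u \<in> Y"
        then have "(X, Y - {u}) \<in> D U" "(X, Y) = ?fY (X, Y - {u})" using D by (auto simp: D_def)
        then show False using * by blast
      qed
      ultimately show False using D *(1) by (auto simp: D_def)
    qed
    show "?R \<subseteq> ?L" using insert by (auto simp: D_def)
  qed
  moreover have "D U \<inter> (?fX ` D U \<union> ?fY ` D U) = {}" "?fX ` D U \<inter> ?fY ` D U = {}"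
    using insert by (auto simp: D_def)
  moreover have "inj_on ?fX (D U)" "inj_on ?fY (D U)"
    using insert by (auto simp: D_def inj_on_def dest: insert_ident[THEN iffD1, rotated 2])
  ultimately have "card (D (insert u U)) = card (D U) + (card (D U) + card (D U))"
    using fin by (simp add: card_Un_disjoint card_image)
  then show ?case using insert by (simp add: D_def)
qed

text \<open>A covering pair for \<open>h\<close> has four extensions by the two bits at
  \<open>Suc h\<close>. At most \<open>3 ^ h\<close> of all these extensions leave
  \<open>Suc h\<close> uncovered.\<close>

lemma card_covering_pairs_Suc:
  "card (covering_pairs (Suc h)) \<le> 4 * card (covering_pairs h)"
  "4 * card (covering_pairs h) \<le> card (covering_pairs (Suc h)) + 3 ^ h"
proof -
  let ?new = "Pow {Suc h} :: nat set set"
  define f where "f = (\<lambda>((A, B), (a, b)). (A \<union> a :: nat set, B \<union> b :: nat set))"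
  define D where "D = f ` (covering_pairs h \<times> (?new \<times> ?new))"
  have inj: "inj_on f (covering_pairs h \<times> (?new \<times> ?new))"
  proof (rule inj_on_inverseI[where g = "\<lambda>(A, B). ((A \<inter> {..h}, B \<inter> {..h}), (A \<inter> {Suc h}, B \<inter> {Suc h}))"])
    fix p assume p: "p \<in> covering_pairs h \<times> (?new \<times> ?new)"
    obtain A B a b where pe: "p = ((A, B), (a, b))" by (cases p) auto
    have "A \<subseteq> {..h}" "B \<subseteq> {..h}" "a \<subseteq> {Suc h}" "b \<subseteq> {Suc h}"
      using p by (auto simp: pe covering_pairs_def)
    then have "(A \<union> a) \<inter> {..h} = A" "(B \<union> b) \<inter> {..h} = B" "(A \<union> a) \<inter> {Suc h} = a" "(B \<union> b) \<inter> {Suc h} = b"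
      by auto
    then show "(\<lambda>(A, B). ((A \<inter> {..h}, B \<inter> {..h}), (A \<inter> {Suc h}, B \<inter> {Suc h}))) (f p) = p"
      by (simp add: pe f_def)
  qed
  have fin: "finite D" unfolding D_def by (intro finite_imageI finite_cartesian_product finite_covering_pairs) auto
  have cD: "card D = 4 * card (covering_pairs h)"
    unfolding D_def card_image[OF inj] by (simp add: card_cartesian_product card_Pow)
  have memD: "(A, B) \<in> D \<longleftrightarrow> A \<subseteq> {..Suc h} \<and> B \<subseteq> {..Suc h} \<and> 0 \<in> A \<and> 0 \<in> B \<and>
      (\<forall>k\<le>h. \<exists>i\<le>k. i \<in> A \<and> k - i \<in> B)" (is "_ \<longleftrightarrow> ?R A B") for A B
  proof
    assume "(A, B) \<in> D"
    then show "?R A B" unfolding D_def f_def covering_pairs_def by fastforce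
  next
    assume R: "?R A B"
    have "(A \<inter> {..h}, B \<inter> {..h}) \<in> covering_pairs h"
      using R unfolding covering_pairs_def by fastforce
    moreover have "(A, B) = f ((A \<inter> {..h}, B \<inter> {..h}), (A \<inter> {Suc h}, B \<inter> {Suc h}))"
      using R by (auto simp: f_def atMost_Suc)
    ultimately show "(A, B) \<in> D" unfolding D_def by blast
  qed
  have sub: "covering_pairs (Suc h) \<subseteq> D"
    using memD by (auto simp: covering_pairs_def)
  show "card (covering_pairs (Suc h)) \<le> 4 * card (covering_pairs h)"
    using card_mono[OF fin sub] cD by simp
  define E where "E = D - covering_pairs (Suc h)"
  define r where "r = (\<lambda>i. Suc h - i)"
  \<comment> \<open>Pairs in \<open>E\<close> leave \<open>Suc h\<close> uncovered, so
    \<open>A\<close> is disjoint from the reflection of \<open>B\<close>. The map \<open>e\<close>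
    forgets only the end points, whose membership is forced.\<close>
  define e where "e = (\<lambda>(A, B). (A \<inter> {1..h}, r ` (B \<inter> {1..h})))"
  have memE: "A \<subseteq> {..Suc h}" "B \<subseteq> {..Suc h}" "0 \<in> A" "0 \<in> B" if "(A, B) \<in> E" for A B
    using that by (simp_all add: E_def memD)
  have missE: "r i \<notin> B" if E: "(A, B) \<in> E" and i: "i \<le> Suc h" "i \<in> A" for A B i
  proof
    assume "r i \<in> B"
    then have "\<exists>i\<le>Suc h. i \<in> A \<and> Suc h - i \<in> B" using i r_def by blast
    then have "\<forall>k\<le>Suc h. \<exists>i\<le>k. i \<in> A \<and> k - i \<in> B"
      using E by (auto simp: E_def memD le_Suc_eq)
    then show False using E memE[OF E] by (auto simp: E_def covering_pairs_def)
  qed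
  have rr: "r (r i) = i" if "i \<le> Suc h" for i using that by (simp add: r_def)
  \<comment> \<open>As \<open>0\<close> lies in both sets, \<open>Suc h\<close> can lie in
    neither.\<close>
  have ends: "A = insert 0 (A \<inter> {1..h})" "B = insert 0 (B \<inter> {1..h})" if "(A, B) \<in> E" for A B
  proof -
    have "Suc h \<notin> A" using memE(4)[OF that] missE[OF that, of "Suc h"] by (auto simp: r_def)
    moreover have "Suc h \<notin> B" using memE(3)[OF that] missE[OF that, of 0] by (auto simp: r_def)
    ultimately have "x \<in> A \<Longrightarrow> x = 0 \<or> x \<in> {1..h}" "x \<in> B \<Longrightarrow> x = 0 \<or> x \<in> {1..h}" for x
      using memE(1,2)[OF that] by (cases "x = Suc h"; force)+
    then show "A = insert 0 (A \<inter> {1..h})" "B = insert 0 (B \<inter> {1..h})"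
      using memE(3,4)[OF that] by blast+
  qed
  have "inj_on e E"
  proof (rule inj_onI, clarify)
    fix A B A' B' assume AB: "(A, B) \<in> E" "(A', B') \<in> E" and eq: "e (A, B) = e (A', B')"
    have "inj_on r {1..h}" by (auto simp: r_def inj_on_def)
    then have "A \<inter> {1..h} = A' \<inter> {1..h}" "B \<inter> {1..h} = B' \<inter> {1..h}"
      using eq inj_on_image_eq_iff[of r "{1..h}" "B \<inter> {1..h}" "B' \<inter> {1..h}"] by (auto simp: e_def)
    then show "A = A' \<and> B = B'" using ends[OF AB(1)] ends[OF AB(2)] by metis
  qed
  moreover have "e ` E \<subseteq> {(X, Y). X \<subseteq> {1..h} \<and> Y \<subseteq> {1..h} \<and> X \<inter> Y = {}}"
  proof (clarsimp simp: e_def, intro conjI)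
    fix A B assume AB: "(A, B) \<in> E"
    show "r ` (B \<inter> {Suc 0..h}) \<subseteq> {Suc 0..h}" by (auto simp: r_def)
    show "A \<inter> {Suc 0..h} \<inter> r ` (B \<inter> {Suc 0..h}) = {}"
      
    proof (intro equals0I, clarsimp)
      fix b assume "r b \<in> A" "b \<in> B" "b \<le> h"
      then show False using missE[OF AB, of "r b"] rr[of b] by (simp add: r_def)
    qed
  qed
  moreover have "finite {(X, Y). X \<subseteq> {1..h} \<and> Y \<subseteq> {1..h} \<and> X \<inter> Y = {}}"
    by (rule finite_subset[of _ "Pow {1..h} \<times> Pow {1..h}"]) auto
  ultimately have "card E \<le> card {(X, Y). X \<subseteq> {1..h} \<and> Y \<subseteq> {1..h} \<and> X \<inter> Y = {}}"
    by (rule card_inj_on_le)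
  then have "card E \<le> 3 ^ h" by (simp add: card_disjoint_subset_pairs del: One_nat_def)
  moreover have "card D = card (covering_pairs (Suc h)) + card E"
    unfolding E_def by (simp add: card_Diff_subset card_mono fin sub finite_covering_pairs)
  ultimately show "4 * card (covering_pairs h) \<le> card (covering_pairs (Suc h)) + 3 ^ h"
    using cD by simp
qed

text \<open>Divide the two counts by \<open>4 ^ Suc h\<close>; the loss
  \<open>3 ^ h / 4 ^ Suc h\<close> equals \<open>(3/4) ^ h - (3/4) ^ Suc h\<close>, so it
  telescopes.\<close>

lemma covering_ratio_Suc:
  "covering_ratio (Suc h) \<le> covering_ratio h"
  "covering_ratio h - (3/4) ^ h \<le> covering_ratio (Suc h) - (3/4) ^ Suc h"
proof -
  have "real (card (covering_pairs (Suc h))) \<le> 4 * real (card (covering_pairs h))"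
    using card_covering_pairs_Suc(1)[of h] by linarith
  then show "covering_ratio (Suc h) \<le> covering_ratio h"
    by (simp add: covering_ratio_def field_simps)
  have "real (4 * card (covering_pairs h)) \<le> real (card (covering_pairs (Suc h)) + 3 ^ h)"
    using card_covering_pairs_Suc(2)[of h] of_nat_le_iff by blast
  then have "(4 * real (card (covering_pairs h)) - 4 * 3 ^ h) / 4 ^ Suc h
      \<le> (real (card (covering_pairs (Suc h))) - 3 ^ Suc h) / 4 ^ Suc h"
    by (intro divide_right_mono) auto
  then show "covering_ratio h - (3/4) ^ h \<le> covering_ratio (Suc h) - (3/4) ^ Suc h"
    by (simp add: covering_ratio_def power_divide diff_divide_distrib)
qed

section \<open>Convergence of the covering ratio\<close>

lemma decseq_covering_ratio: "decseq covering_ratio"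
  by (simp add: decseq_Suc_iff covering_ratio_Suc)

text \<open>The ratio decreases and is nonnegative; subtracting \<open>(3/4) ^ h\<close> gives an
  increasing sequence with the same limit. Every index thus brackets the limit.\<close>

lemma covering_ratio_limit_bounds:
  obtains L where "covering_ratio \<longlonglongrightarrow> L" "covering_ratio n - (3/4) ^ n \<le> L" "L \<le> covering_ratio n"
proof -
  obtain L where L: "covering_ratio \<longlonglongrightarrow> L" "\<forall>i. L \<le> covering_ratio i"
    using decseq_convergent[OF decseq_covering_ratio, of 0]
    by (auto simp: covering_ratio_def)
  have "incseq (\<lambda>h. covering_ratio h - (3/4) ^ h)"
    unfolding incseq_Suc_iff using covering_ratio_Suc(2) by blast
  moreover have "(\<lambda>h. covering_ratio h - (3/4) ^ h) \<longlonglongrightarrow> L - 0"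
    by (intro tendsto_diff L LIMSEQ_realpow_zero) auto
  ultimately have "covering_ratio n - (3/4) ^ n \<le> L"
    using incseq_le by fastforce
  then show ?thesis using that L by blast
qed


section \<open>Counting by a search over prefixes\<close>

text \<open>The bound is \<open>17 = 2 * 8 + 1\<close>: as long as \<open>k \<le> 17\<close>, one of the summands of \<open>k\<close> lies in a prefix
  with indices \<open>0..8\<close>.\<close>

definition extensions :: "bool list \<Rightarrow> bool list \<Rightarrow> (nat set \<times> nat set) set" where
  "extensions xs ys = {(A, B). A \<subseteq> {..17} \<and> B \<subseteq> {..17} \<and>
     (\<forall>i<length xs. i \<in> A \<longleftrightarrow> xs ! i) \<and> (\<forall>i<length ys. i \<in> B \<longleftrightarrow> ys ! i)}"

definition uncovered :: "nat \<Rightarrow> (nat set \<times> nat set) set" where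
  "uncovered k = {(A, B). \<forall>i\<le>k. \<not> (i \<in> A \<and> k - i \<in> B)}"

definition bad :: "bool list \<Rightarrow> bool list \<Rightarrow> (nat set \<times> nat set) set" where
  "bad xs ys = extensions xs ys \<inter> (\<Union>k\<le>17. uncovered k)"

lemma finite_extensions [simp]: "finite (extensions xs ys)"
  by (rule finite_subset[of _ "Pow {..17} \<times> Pow {..17}"]) (auto simp: extensions_def)

lemma finite_bad [simp]: "finite (bad xs ys)"
  by (simp add: bad_def)

lemma extensions_snoc:
  assumes "(A, B) \<in> extensions xs ys"
  shows "(A, B) \<in> extensions (xs @ [length xs \<in> A]) (ys @ [length ys \<in> B])"
  using assms by (auto simp: extensions_def nth_append less_Suc_eq)

lemma extensions_snoc_subset: "extensions (xs @ [x]) (ys @ [y]) \<subseteq> extensions xs ys"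
  unfolding extensions_def by (clarsimp simp: nth_append)

lemma extensions_snoc_iff:
  assumes "(A, B) \<in> extensions (xs @ [x]) (ys @ [y])"
  shows "length xs \<in> A \<longleftrightarrow> x" "length ys \<in> B \<longleftrightarrow> y"
  using assms by (auto simp: extensions_def nth_append)

lemma card_bad_split:
  "card (bad xs ys) = card (bad (xs @ [False]) (ys @ [False])) + card (bad (xs @ [False]) (ys @ [True]))
    + (card (bad (xs @ [True]) (ys @ [False])) + card (bad (xs @ [True]) (ys @ [True])))"
proof -
  let ?b = "\<lambda>x y. bad (xs @ [x]) (ys @ [y])"
  have "bad xs ys = (?b False False \<union> ?b False True) \<union> (?b True False \<union> ?b True True)" (is "_ = ?R")
  proof
    show "bad xs ys \<subseteq> ?R"
    proof (rule subrelI)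
      fix A B assume "(A, B) \<in> bad xs ys"
      then have "(A, B) \<in> ?b (length xs \<in> A) (length ys \<in> B)"
        using extensions_snoc by (auto simp: bad_def)
      then show "(A, B) \<in> ?R" by (cases "length xs \<in> A"; cases "length ys \<in> B") auto
    qed
    show "?R \<subseteq> bad xs ys"
      using extensions_snoc_subset unfolding bad_def by blast
  qed
  moreover have disj: "?b x y \<inter> ?b x' y' = {}" if "x \<noteq> x' \<or> y \<noteq> y'" for x y x' y'
  proof (rule equals0I, clarify)
    fix A B assume "(A, B) \<in> ?b x y" "(A, B) \<in> ?b x' y'"
    then have "(A, B) \<in> extensions (xs @ [x]) (ys @ [y])" "(A, B) \<in> extensions (xs @ [x']) (ys @ [y'])"
      by (auto simp: bad_def)
    then show False using that extensions_snoc_iff by metis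
  qed
  have "?b False False \<inter> ?b False True = {}" "?b True False \<inter> ?b True True = {}"
    "(?b False False \<union> ?b False True) \<inter> (?b True False \<union> ?b True True) = {}"
    by (simp_all add: Int_Un_distrib Int_Un_distrib2 disj)
  ultimately show ?thesis by (simp only: card_Un_disjoint finite_bad finite_Un)
qed

text \<open>Exchanging the summands \<open>i\<close> and \<open>k - i\<close> exchanges the two
  sets. This saves one of the searches below.\<close>

lemma card_bad_swap: "card (bad xs ys) = card (bad ys xs)"
proof (rule bij_betw_same_card)
  have swap: "(B, A) \<in> bad ys xs" if AB: "(A, B) \<in> bad xs ys" for A B xs ys
  proof -
    obtain k where k: "k \<le> 17" "\<forall>i\<le>k. \<not> (i \<in> A \<and> k - i \<in> B)"
      using AB by (auto simp: bad_def uncovered_def)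
    have "\<not> (i \<in> B \<and> k - i \<in> A)" if "i \<le> k" for i
      using k(2)[rule_format, of "k - i"] that by auto
    then show ?thesis
      using AB k(1) by (auto simp: bad_def uncovered_def extensions_def)
  qed
  show "bij_betw prod.swap (bad xs ys) (bad ys xs)"
    by (rule bij_betw_byWitness[where f' = prod.swap]) (auto intro: swap)
qed

section \<open>Counting pairs with prescribed empty positions\<close>

definition avoiding :: "bool list \<Rightarrow> bool list \<Rightarrow> nat set \<Rightarrow> nat set \<Rightarrow> (nat set \<times> nat set) set" where
  "avoiding xs ys Q P = {(A, B) \<in> extensions xs ys. A \<inter> Q = {} \<and> B \<inter> P = {}}"

lemma avoiding_subset: "avoiding xs ys Q P \<subseteq> extensions xs ys"
  by (auto simp: avoiding_def)

lemma finite_avoiding [simp]: "finite (avoiding xs ys Q P)"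
  by (rule finite_subset[OF avoiding_subset]) simp

text \<open>Such events are closed under intersection, so pairwise intersections are counted by the
  same power of two formula as single events.\<close>

lemma avoiding_Int: "avoiding xs ys Q P \<inter> avoiding xs ys Q' P' = avoiding xs ys (Q \<union> Q') (P \<union> P')"
  by (auto simp: avoiding_def)

text \<open>Of the 18 positions \<open>0..17\<close>, the first \<open>n\<close> are fixed and those
  in \<open>Z\<close> are empty; the others are free.\<close>

lemma card_sets_with_prefix:
  assumes n: "length xs = n" "n \<le> 18" and Z: "Z \<subseteq> {n..17}"
  shows "card {A. A \<subseteq> {..17} \<and> (\<forall>i<n. i \<in> A \<longleftrightarrow> xs ! i) \<and> A \<inter> Z = {}} = 2 ^ (18 - n - card Z)"
proof -
  have "bij_betw (\<lambda>A. A \<union> {i. i < n \<and> xs ! i}) (Pow ({n..17} - Z))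
      {A. A \<subseteq> {..17} \<and> (\<forall>i<n. i \<in> A \<longleftrightarrow> xs ! i) \<and> A \<inter> Z = {}}"
    by (rule bij_betw_byWitness[where f' = "\<lambda>A. A \<inter> {n..}"]) (use n Z in \<open>force+\<close>)
  moreover have "card ({n..17} - Z) = 18 - n - card Z"
    using Z by (simp add: card_Diff_subset finite_subset)
  ultimately show ?thesis by (simp add: bij_betw_same_card[symmetric] card_Pow)
qed

lemma card_avoiding:
  assumes "length xs = n" "length ys = n" "n \<le> 18" "Q \<subseteq> {n..17}" "P \<subseteq> {n..17}"
  shows "card (avoiding xs ys Q P) = 2 ^ (2 * (18 - n) - (card P + card Q))"
proof -
  have "avoiding xs ys Q P = {A. A \<subseteq> {..17} \<and> (\<forall>i<n. i \<in> A \<longleftrightarrow> xs ! i) \<and> A \<inter> Q = {}} \<times>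
      {B. B \<subseteq> {..17} \<and> (\<forall>i<n. i \<in> B \<longleftrightarrow> ys ! i) \<and> B \<inter> P = {}}"
    using assms by (auto simp: avoiding_def extensions_def)
  moreover have "card Q \<le> 18 - n" "card P \<le> 18 - n"
    using card_mono[OF _ assms(4)] card_mono[OF _ assms(5)] by auto
  then have "2 * (18 - n) - (card P + card Q) = (18 - n - card Q) + (18 - n - card P)" by linarith
  ultimately show ?thesis
    using assms by (simp add: card_cartesian_product card_sets_with_prefix power_add[symmetric])
qed

lemma card_extensions:
  assumes "length xs = n" "length ys = n" "n \<le> 18"
  shows "card (extensions xs ys) = 4 ^ (18 - n)"
proof -
  have "extensions xs ys = avoiding xs ys {} {}" by (auto simp: avoiding_def)
  then show ?thesis using card_avoiding[OF assms, of "{}" "{}"] by (simp add: power_mult)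
qed

subsection \<open>The search\<close>

text \<open>With the second list reversed, this is membership in a sumset.\<close>

fun meets :: "bool list \<Rightarrow> bool list \<Rightarrow> bool" where
  "meets [] ys = False"
| "meets (x # xs) [] = False"
| "meets (False # xs) (y # ys) = meets xs ys"
| "meets (True # xs) (False # ys) = meets xs ys"
| "meets (True # xs) (True # ys) = True"

lemma meets_iff: "meets xs ys \<longleftrightarrow> (\<exists>i<min (length xs) (length ys). xs ! i \<and> ys ! i)"
proof (induction xs ys rule: meets.induct)
  case (3 xs y ys)
  then show ?case by (auto simp: less_Suc_eq_0_disj gr0_conv_Suc)
next
  case (4 xs ys)
  then show ?case by (auto simp: less_Suc_eq_0_disj)
qed auto

fun positions :: "nat \<Rightarrow> bool list \<Rightarrow> nat set" where
  "positions n [] = {}"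
| "positions n (True # z) = insert n (positions (Suc n) z)"
| "positions n (False # z) = positions (Suc n) z"

lemma positions_conv_nth: "positions n z = {n + p |p. p < length z \<and> z ! p}"
proof (induction n z rule: positions.induct)
  case (2 n z)
  then show ?case by (force simp: less_Suc_eq_0_disj)
next
  case (3 n z)
  then show ?case by (force simp: less_Suc_eq_0_disj)
qed auto

lemma positions_subset: "positions n z \<subseteq> {n..<n + length z}"
  by (auto simp: positions_conv_nth)

lemma finite_positions [simp]: "finite (positions n z)"
  by (rule finite_subset[OF positions_subset]) simp

lemma notin_positions_Suc [simp]: "n \<notin> positions (Suc n) z"
  by (auto simp: positions_conv_nth)

text \<open>Cardinalities are recorded by shortening a list of weights, so that the powers of two that
  are needed can be read off without arithmetic.\<close>

fun drop_card :: "bool list \<Rightarrow> int list \<Rightarrow> int list" where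
  "drop_card [] ws = ws"
| "drop_card (True # z) ws = drop_card z (tl ws)"
| "drop_card (False # z) ws = drop_card z ws"

fun drop_card_union :: "bool list \<Rightarrow> bool list \<Rightarrow> int list \<Rightarrow> int list" where
  "drop_card_union [] z ws = drop_card z ws"
| "drop_card_union (a # u) [] ws = drop_card (a # u) ws"
| "drop_card_union (True # u) (b # z) ws = drop_card_union u z (tl ws)"
| "drop_card_union (False # u) (True # z) ws = drop_card_union u z (tl ws)"
| "drop_card_union (False # u) (False # z) ws = drop_card_union u z ws"

lemma drop_card: "drop_card z ws = drop (card (positions n z)) ws"
  by (induction n z arbitrary: ws rule: positions.induct) (auto simp: drop_Suc)

lemma drop_card_union:
  "drop_card_union u z ws = drop (card (positions n u \<union> positions n z)) ws"
proof (induction u z ws arbitrary: n rule: drop_card_union.induct)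
  case (3 u b z ws)
  have "positions n (True # u) \<union> positions n (b # z) = insert n (positions (Suc n) u \<union> positions (Suc n) z)"
    by (cases b) auto
  then show ?case using 3 by (simp add: drop_Suc)
next
  case (4 u z ws)
  have "positions n (False # u) \<union> positions n (True # z) = insert n (positions (Suc n) u \<union> positions (Suc n) z)"
    by auto
  then show ?case using 4 by (simp add: drop_Suc)
next
  case (1 z ws)
  show ?case by (simp add: drop_card[of _ _ n])
next
  case (2 a u ws)
  show ?case by (simp only: drop_card_union.simps drop_card[of _ _ n] positions.simps(1) Un_empty_right)
next
  case (5 u z ws)
  then show ?case by simp
qed

text \<open>The powers \<open>2 ^ 18\<close> down to \<open>1\<close>: two prefixes of length 9
  leave \<open>2 * 9 = 18\<close> free bits, and each forced vacancy halves the count.\<close>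

definition weights :: "int list" where
  "weights = [262144, 131072, 65536, 32768, 16384, 8192, 4096, 2048, 1024, 512, 256, 128, 64, 32, 16, 8, 4, 2, 1]"

lemma hd_drop_weights:
  assumes "m \<le> 18"
  shows "hd (drop m weights) = 2 ^ (18 - m)"
proof -
  have "\<forall>m\<in>{..18}. hd (drop m weights) = 2 ^ (18 - m)"
    by (simp add: weights_def atMost_nat_numeral atMost_Suc numeral_eq_Suc)
  then show ?thesis using assms by auto
qed

fun rev_onto :: "bool list \<Rightarrow> bool list \<Rightarrow> bool list" where
  "rev_onto [] a = a"
| "rev_onto (x # xs) a = rev_onto xs (x # a)"

lemma rev_onto: "rev_onto xs a = rev xs @ a"
  by (induction xs a rule: rev_onto.induct) auto

text \<open>For prefixes of length \<open>n\<close>, position \<open>n + t\<close> is uncovered iff no two prefix elements add up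
  to it and no new element meets a prefix element. The second condition says that \<open>A\<close> and \<open>B\<close> avoid
  the reflections of the initial segments of the prefixes of \<open>B\<close> and \<open>A\<close> of length \<open>t + 1\<close>.\<close>

fun events :: "bool list \<Rightarrow> bool list \<Rightarrow> bool list \<Rightarrow> bool list \<Rightarrow> bool list \<Rightarrow> (bool list \<times> bool list) list" where
  "events [] ys yr P Q = []"
| "events (x # xs) [] yr P Q = []"
| "events (x # xs) (y # ys) yr P Q =
    (if meets xs yr then events xs ys yr (y # P) (x # Q)
     else (y # P, x # Q) # events xs ys yr (y # P) (x # Q))"

fun overlap :: "bool list \<Rightarrow> bool list \<Rightarrow> (bool list \<times> bool list) list \<Rightarrow> int" where
  "overlap P Q [] = 0"
| "overlap P Q ((P', Q') # es) = hd (drop_card_union P P' (drop_card_union Q Q' weights)) + overlap P Q es"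

text \<open>An event adds to the union at least its own size minus its overlaps with the earlier
  events in \<open>acc\<close>. Summing the overlaps can overcount, so the difference is cut off at
  \<open>0\<close>. The upper bound just adds the sizes.\<close>

fun union_bounds :: "(bool list \<times> bool list) list \<Rightarrow> (bool list \<times> bool list) list \<Rightarrow> int \<Rightarrow> int \<Rightarrow> int \<times> int" where
  "union_bounds acc [] l u = (l, u)"
| "union_bounds acc ((P, Q) # es) l u =
    (let w = hd (drop_card P (drop_card Q weights))
     in union_bounds ((P, Q) # acc) es (l + max 0 (w - overlap P Q acc)) (u + w))"

definition leaf_bounds :: "bool list \<Rightarrow> bool list \<Rightarrow> int \<times> int" where
  "leaf_bounds xr yr =
    (let xs = rev_onto xr []; ys = rev_onto yr [] in union_bounds [] (events xs ys yr [] []) 0 0)"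

fun add_bounds :: "int \<times> int \<Rightarrow> int \<times> int \<Rightarrow> int \<times> int" where
  "add_bounds (a, b) (c, d) = (a + c, b + d)"

text \<open>The prefixes are kept reversed. The head of the weight list is the number of extensions of
  a prefix that is one bit longer; it is added in full as soon as the newest position is uncovered.\<close>

fun search :: "int list \<Rightarrow> bool list \<Rightarrow> bool list \<Rightarrow> int \<times> int" where
  "search [] xr yr = leaf_bounds xr yr"
| "search (f # fs) xr yr =
    (let go = (\<lambda>xr yr. if meets (rev_onto xr []) yr then search fs xr yr else (f, f))
     in add_bounds (add_bounds (go (False # xr) (False # yr)) (go (False # xr) (True # yr)))
          (add_bounds (go (True # xr) (False # yr)) (go (True # xr) (True # yr))))"

definition bounds :: "nat \<Rightarrow> int \<times> int \<Rightarrow> bool" where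
  "bounds c p \<longleftrightarrow> fst p \<le> int c \<and> int c \<le> snd p"

lemma bounds_add: "bounds c p \<Longrightarrow> bounds d q \<Longrightarrow> bounds (c + d) (add_bounds p q)"
  by (cases p; cases q) (auto simp: bounds_def)

section \<open>Estimates for a pair of prefixes of length 9\<close>

context
  fixes xs ys :: "bool list"
  assumes len: "length xs = 9" "length ys = 9"
begin

abbreviation avoid :: "bool list \<times> bool list \<Rightarrow> (nat set \<times> nat set) set" where
  "avoid e \<equiv> avoiding xs ys (positions 9 (fst e)) (positions 9 (snd e))"

lemma positions_le: "length z \<le> 9 \<Longrightarrow> positions 9 z \<subseteq> {9..17}"
  using positions_subset[of 9 z] by auto

lemma card_positions_le:
  assumes "Z \<subseteq> {9..17::nat}"
  shows "card Z \<le> 9"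
  using card_mono[OF _ assms] by simp

lemma card_avoid:
  assumes "length P \<le> 9" "length Q \<le> 9"
  shows "int (card (avoid (P, Q))) = hd (drop_card P (drop_card Q weights))"
proof -
  have "card (positions 9 P) \<le> 9" "card (positions 9 Q) \<le> 9"
    using assms card_positions_le positions_le by blast+
  then show ?thesis
    using assms positions_le card_avoiding[OF len, of "positions 9 P" "positions 9 Q"]
    by (simp add: drop_card[of _ _ 9] hd_drop_weights add.commute)
qed

lemma card_avoid_Int:
  assumes "length P \<le> 9" "length Q \<le> 9" "length P' \<le> 9" "length Q' \<le> 9"
  shows "int (card (avoid (P, Q) \<inter> avoid (P', Q')))
    = hd (drop_card_union P P' (drop_card_union Q Q' weights))"
proof -
  have sub: "positions 9 P \<union> positions 9 P' \<subseteq> {9..17}" "positions 9 Q \<union> positions 9 Q' \<subseteq> {9..17}"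
    using assms positions_le by auto
  show ?thesis
    using card_avoiding[OF len _ sub] card_positions_le[OF sub(1)] card_positions_le[OF sub(2)]
    by (simp add: avoiding_Int drop_card_union[of _ _ _ 9] hd_drop_weights add.commute)
qed

definition short :: "(bool list \<times> bool list) list \<Rightarrow> bool" where
  "short es \<longleftrightarrow> (\<forall>(P, Q)\<in>set es. length P \<le> 9 \<and> length Q \<le> 9)"

lemma overlap:
  assumes "short ((P, Q) # acc)"
  shows "int (card (avoid (P, Q) \<inter> (\<Union>e\<in>set acc. avoid e))) \<le> overlap P Q acc"
  using assms
proof (induction acc)
  case (Cons e acc)
  obtain P' Q' where e: "e = (P', Q')" by (cases e)
  have "card (avoid (P, Q) \<inter> (\<Union>e\<in>set (e # acc). avoid e))
      \<le> card (avoid (P, Q) \<inter> avoid e) + card (avoid (P, Q) \<inter> (\<Union>e\<in>set acc. avoid e))"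
    by (simp add: Int_Un_distrib card_Un_le)
  moreover have "int (card (avoid (P, Q) \<inter> avoid e)) = hd (drop_card_union P P' (drop_card_union Q Q' weights))"
    unfolding e by (rule card_avoid_Int) (use Cons.prems e in \<open>auto simp: short_def\<close>)
  ultimately show ?case using Cons e by (simp add: short_def)
qed simp

text \<open>For the induction, the lower bound concerns only what the remaining events add outside
  those in \<open>acc\<close>. With \<open>acc\<close> empty and \<open>l = u = 0\<close>, both
  bounds concern the whole union.\<close>

lemma union_bounds:
  assumes "short (acc @ es)"
  shows "fst (union_bounds acc es l u) \<le> l + int (card ((\<Union>e\<in>set es. avoid e) - (\<Union>e\<in>set acc. avoid e)))
    \<and> u + int (card (\<Union>e\<in>set es. avoid e)) \<le> snd (union_bounds acc es l u)"
  using assms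
proof (induction acc es l u rule: union_bounds.induct)
  case (2 acc P Q es l u)
  define w where "w = hd (drop_card P (drop_card Q weights))"
  define V where "V = avoid (P, Q)"
  define R where "R = (\<Union>e\<in>set es. avoid e)"
  define S where "S = (\<Union>e\<in>set acc. avoid e)"
  have fin: "finite V" "finite R" "finite S" by (auto simp: V_def R_def S_def)
  have w: "int (card V) = w"
    unfolding V_def w_def by (rule card_avoid) (use 2(2) in \<open>auto simp: short_def\<close>)
  have "int (card (V \<inter> S)) \<le> overlap P Q acc"
    unfolding V_def S_def by (rule overlap) (use 2(2) in \<open>auto simp: short_def\<close>)
  moreover have "card V = card (V \<inter> S) + card (V - S)"
    using fin by (metis card_Int_Diff)
  ultimately have lo: "max 0 (w - overlap P Q acc) \<le> int (card (V - S))" using w by linarith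
  \<comment> \<open>The new part splits into what the current event adds and what the later events
    add beyond it.\<close>
  have "(V \<union> R) - S = (V - S) \<union> (R - (V \<union> S))" by auto
  then have "card ((V \<union> R) - S) = card (V - S) + card (R - (V \<union> S))"
    using card_Un_disjoint[of "V - S" "R - (V \<union> S)"] fin by auto
  then have lo': "l + max 0 (w - overlap P Q acc) + int (card (R - (V \<union> S))) \<le> l + int (card ((V \<union> R) - S))"
    using lo by linarith
  have hi': "u + int (card (V \<union> R)) \<le> u + w + int (card R)"
    using card_Un_le[of V R] w by linarith
  have IH: "fst (union_bounds ((P, Q) # acc) es (l + max 0 (w - overlap P Q acc)) (u + w))
      \<le> l + max 0 (w - overlap P Q acc) + int (card (R - (V \<union> S)))
    \<and> u + w + int (card R) \<le> snd (union_bounds ((P, Q) # acc) es (l + max 0 (w - overlap P Q acc)) (u + w))"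
    using 2(1)[OF w_def] 2(2) by (simp add: short_def R_def S_def V_def)
  have un: "(\<Union>e\<in>set ((P, Q) # es). avoid e) = V \<union> R" by (simp add: V_def R_def)
  have step: "union_bounds acc ((P, Q) # es) l u
      = union_bounds ((P, Q) # acc) es (l + max 0 (w - overlap P Q acc)) (u + w)"
    by (simp add: w_def Let_def)
  show ?case unfolding un step S_def[symmetric] using lo' hi' IH by linarith
qed auto


text \<open>In the sum \<open>9 + s\<close>, index \<open>j \<le> s\<close> has its partner
  \<open>9 + s - j\<close> beyond the prefix. Reversing the initial segment lists these partners
  upwards from \<open>9\<close>.\<close>

lemma positions_rev_take:
  assumes "length zs = 9" "s < 9"
  shows "positions 9 (rev (take (Suc s) zs)) = {9 + s - j |j. j \<le> s \<and> zs ! j}"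
proof -
  have nth: "rev (take (Suc s) zs) ! p \<longleftrightarrow> zs ! (s - p)" if "p \<le> s" for p
    using assms that by (simp add: rev_nth)
  show ?thesis
  proof (rule set_eqI, rule iffI)
    fix q assume "q \<in> positions 9 (rev (take (Suc s) zs))"
    then obtain p where "q = 9 + p" "p \<le> s" "zs ! (s - p)"
      using assms nth by (auto simp: positions_conv_nth less_Suc_eq_le)
    then have "q = 9 + s - (s - p) \<and> s - p \<le> s \<and> zs ! (s - p)" by simp
    then show "q \<in> {9 + s - j |j. j \<le> s \<and> zs ! j}" by blast
  next
    fix q assume "q \<in> {9 + s - j |j. j \<le> s \<and> zs ! j}"
    then obtain j where "q = 9 + s - j" "j \<le> s" "zs ! j" by blast
    then have "q = 9 + (s - j)" "s - j < length (rev (take (Suc s) zs))" "rev (take (Suc s) zs) ! (s - j)"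
      using assms nth[of "s - j"] by auto
    then show "q \<in> positions 9 (rev (take (Suc s) zs))" unfolding positions_conv_nth by blast
  qed
qed

text \<open>For the sum \<open>9 + s\<close>, both summands lie within the prefixes exactly when
  \<open>s < i < 9\<close>.\<close>

lemma meets_drop_rev:
  assumes "s < 9"
  shows "meets (drop (Suc s) xs) (rev ys) \<longleftrightarrow> (\<exists>i. s < i \<and> i < 9 \<and> xs ! i \<and> ys ! (9 + s - i))"
proof
  assume "meets (drop (Suc s) xs) (rev ys)"
  then obtain p where p: "p < 8 - s" "xs ! (Suc s + p)" "ys ! (8 - p)"
    using len by (auto simp: meets_iff rev_nth)
  then have "s < Suc s + p" "Suc s + p < 9" "8 - p = 9 + s - (Suc s + p)" by auto
  then show "\<exists>i. s < i \<and> i < 9 \<and> xs ! i \<and> ys ! (9 + s - i)" using p by metis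
next
  assume "\<exists>i. s < i \<and> i < 9 \<and> xs ! i \<and> ys ! (9 + s - i)"
  then obtain i where i: "s < i" "i < 9" "xs ! i" "ys ! (9 + s - i)" by blast
  define p where "p = i - Suc s"
  have "i = Suc s + p" "9 + s - i = 8 - p" "p < 8 - s" using i p_def by auto
  then have "p < min (length (drop (Suc s) xs)) (length (rev ys))" "drop (Suc s) xs ! p" "rev ys ! p"
    using i len by (auto simp: rev_nth)
  then show "meets (drop (Suc s) xs) (rev ys)" unfolding meets_iff by blast
qed

text \<open>Split by the first summand \<open>i\<close>: for \<open>i \<le> s\<close> the prefix of
  \<open>A\<close> decides which positions of \<open>B\<close> must be empty, for
  \<open>s < i < 9\<close> both bits are known, and for \<open>i \<ge> 9\<close> the prefix of
  \<open>B\<close> restricts \<open>A\<close>. The summands cannot both exceed \<open>8\<close>,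
  since \<open>9 + s < 18\<close>.\<close>

lemma uncovered_iff:
  assumes AB: "(A, B) \<in> extensions xs ys" and s: "s < 9"
  shows "(A, B) \<in> uncovered (9 + s) \<longleftrightarrow> \<not> meets (drop (Suc s) xs) (rev ys) \<and>
    (A, B) \<in> avoid (rev (take (Suc s) ys), rev (take (Suc s) xs))"
proof -
  have A: "i \<in> A \<longleftrightarrow> xs ! i" and B: "i \<in> B \<longleftrightarrow> ys ! i" if "i < 9" for i
    using AB len that by (auto simp: extensions_def)
  have mem: "(A, B) \<in> avoid (rev (take (Suc s) ys), rev (take (Suc s) xs)) \<longleftrightarrow>
      (\<forall>j\<le>s. ys ! j \<longrightarrow> 9 + s - j \<notin> A) \<and> (\<forall>j\<le>s. xs ! j \<longrightarrow> 9 + s - j \<notin> B)"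
    using AB len s by (auto simp: avoiding_def positions_rev_take)
  show ?thesis unfolding mem meets_drop_rev[OF s]
  proof (intro iffI conjI allI impI notI; (elim conjE exE)?)
    fix i assume U: "(A, B) \<in> uncovered (9 + s)" and i: "s < i" "i < 9" "xs ! i" "ys ! (9 + s - i)"
    then have "i \<in> A" "9 + s - i \<in> B" using A[of i] B[of "9 + s - i"] by auto
    then show False using U i by (auto simp: uncovered_def)
  next
    fix j assume U: "(A, B) \<in> uncovered (9 + s)" and j: "j \<le> s" "ys ! j" "9 + s - j \<in> A"
    then have "j \<in> B" "9 + s - (9 + s - j) = j" using B[of j] s by auto
    moreover have "\<not> (9 + s - j \<in> A \<and> 9 + s - (9 + s - j) \<in> B)"
      using U by (simp add: uncovered_def)
    ultimately show False using j(3) by simp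
  next
    fix j assume U: "(A, B) \<in> uncovered (9 + s)" and j: "j \<le> s" "xs ! j" "9 + s - j \<in> B"
    then have "j \<in> A" using A[of j] s by auto
    then show False using U j by (auto simp: uncovered_def)
  next
    assume nm: "\<not> (\<exists>i. s < i \<and> i < 9 \<and> xs ! i \<and> ys ! (9 + s - i))"
      and hA: "\<forall>j\<le>s. ys ! j \<longrightarrow> 9 + s - j \<notin> A" and hB: "\<forall>j\<le>s. xs ! j \<longrightarrow> 9 + s - j \<notin> B"
    have "\<not> (i \<in> A \<and> 9 + s - i \<in> B)" if i: "i \<le> 9 + s" for i
    proof
      assume iA: "i \<in> A \<and> 9 + s - i \<in> B"
      consider "i \<le> s" | "s < i" "i < 9" | "9 \<le> i" by linarith
      then show False
      proof cases
        case 1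
        then show ?thesis using hB A[of i] iA s by auto
      next
        case 2
        then have "9 + s - i < 9" by linarith
        then have "xs ! i" "ys ! (9 + s - i)" using A[OF 2(2)] B iA by blast+
        then show ?thesis using nm 2 by blast
      next
        case 3
        define j where "j = 9 + s - i"
        have j: "j \<le> s" "j < 9" "i = 9 + s - j" using 3 i s unfolding j_def by linarith+
        have "j \<in> B" using iA by (simp add: j_def)
        then have "ys ! j" using B[OF j(2)] by simp
        then show ?thesis using hA j iA by blast
      qed
    qed
    then show "(A, B) \<in> uncovered (9 + s)" by (simp add: uncovered_def)
  qed
qed

lemma set_events:
  assumes "length us = length vs"
  shows "set (events us vs yr P Q) = {(rev (take (Suc s) vs) @ P, rev (take (Suc s) us) @ Q) |s.
    s < length us \<and> \<not> meets (drop (Suc s) us) yr}"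
  using assms
proof (induction us vs yr P Q rule: events.induct)
  case (3 x us y vs yr P Q)
  let ?E = "\<lambda>s. (rev (take (Suc s) (y # vs)) @ P, rev (take (Suc s) (x # us)) @ Q)"
  let ?ok = "\<lambda>s. \<not> meets (drop (Suc s) (x # us)) yr"
  have "set (events us vs yr (y # P) (x # Q)) = {?E (Suc s) |s. s < length us \<and> ?ok (Suc s)}"
    using 3 by (cases "meets us yr") simp_all
  moreover have "{?E s |s. s < length (x # us) \<and> ?ok s}
      = {?E 0 |s::nat. ?ok 0} \<union> {?E (Suc s) |s. s < length us \<and> ?ok (Suc s)}"
    by (auto simp: less_Suc_eq_0_disj)
  ultimately show ?case by auto
qed auto

text \<open>Positions below \<open>9\<close> are covered by the prefixes themselves, so
  \<open>bad\<close> is exactly the union of the events for \<open>9..17\<close>.\<close>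

lemma leaf_bounds:
  assumes cov: "\<forall>k<9. \<exists>i\<le>k. xs ! i \<and> ys ! (k - i)"
  shows "bounds (card (bad xs ys)) (leaf_bounds (rev xs) (rev ys))"
proof -
  define es where "es = events xs ys (rev ys) [] []"
  have es: "set es = {(rev (take (Suc s) ys), rev (take (Suc s) xs)) |s.
      s < 9 \<and> \<not> meets (drop (Suc s) xs) (rev ys)}"
    using set_events[of xs ys "rev ys" "[]" "[]"] len by (simp add: es_def)
  have "bad xs ys = (\<Union>e\<in>set es. avoid e)"
  proof (rule set_eqI, clarify)
    fix A B
    show "(A, B) \<in> bad xs ys \<longleftrightarrow> (A, B) \<in> (\<Union>e\<in>set es. avoid e)"
    proof
      assume "(A, B) \<in> bad xs ys"
      then obtain k where AB: "(A, B) \<in> extensions xs ys" and k: "k \<le> 17" "(A, B) \<in> uncovered k"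
        by (auto simp: bad_def)
      have "\<not> k < 9"
      proof
        assume "k < 9"
        then obtain i where i: "i \<le> k" "xs ! i" "ys ! (k - i)" using cov by blast
        then have "i \<in> A" "k - i \<in> B" using AB \<open>k < 9\<close> len by (auto simp: extensions_def)
        then show False using k(2) i(1) by (auto simp: uncovered_def)
      qed
      then obtain s where s: "k = 9 + s" by (metis le_Suc_ex not_less)
      then have "s < 9" using k by simp
      then show "(A, B) \<in> (\<Union>e\<in>set es. avoid e)"
        using uncovered_iff[OF AB] k(2) s unfolding es by blast
    next
      assume "(A, B) \<in> (\<Union>e\<in>set es. avoid e)"
      then obtain s where s: "s < 9" "\<not> meets (drop (Suc s) xs) (rev ys)"
        and "(A, B) \<in> avoid (rev (take (Suc s) ys), rev (take (Suc s) xs))"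
        unfolding es by blast
      moreover from this have AB: "(A, B) \<in> extensions xs ys" by (simp add: avoiding_def)
      ultimately have "(A, B) \<in> uncovered (9 + s)" using uncovered_iff[OF AB] by blast
      moreover have "9 + s \<le> 17" using s by simp
      ultimately show "(A, B) \<in> bad xs ys" using AB unfolding bad_def by blast
    qed
  qed
  moreover have "short ([] @ es)"
    using es len by (auto simp: short_def)
  ultimately show ?thesis
    using union_bounds[of "[]" es 0 0] by (simp add: bounds_def leaf_bounds_def rev_onto es_def)
qed

end

text \<open>All summands of \<open>m\<close> lie in the prefixes of length \<open>Suc m\<close>, so
  the new bits settle whether \<open>m\<close> is covered. If not, all \<open>4 ^ (17 - m)\<close>
  extensions are bad; otherwise the coverage invariant passes on until \<open>leaf_bounds\<close>
  applies.\<close>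

lemma search_bounds:
  assumes "length xr = m" "length yr = m" "m + length fs = 9" "fs = map (\<lambda>i. 4 ^ (17 - i)) [m..<9]"
    and "\<forall>k<m. \<exists>i\<le>k. rev xr ! i \<and> rev yr ! (k - i)"
  shows "bounds (card (bad (rev xr) (rev yr))) (search fs xr yr)"
  using assms
proof (induction fs arbitrary: m xr yr)
  case Nil
  then show ?case using leaf_bounds[of "rev xr" "rev yr"] by simp
next
  case (Cons f fs)
  have m: "m < 9" using Cons.prems(3) unfolding length_Cons by linarith
  have fs: "f = 4 ^ (17 - m)" "fs = map (\<lambda>i. 4 ^ (17 - i)) [Suc m..<9]"
    using Cons.prems(4) m by (simp_all add: upt_conv_Cons)
  have go: "bounds (card (bad (rev xr @ [x]) (rev yr @ [y])))
      (if meets (rev_onto (x # xr) []) (y # yr) then search fs (x # xr) (y # yr) else (f, f))" for x y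
  proof -
    let ?xs = "rev xr @ [x]" and ?ys = "rev yr @ [y]"
    have "(y # yr) ! i = ?ys ! (m - i)" if "i \<le> m" for i
      using that Cons.prems(2) by (cases i) (auto simp: nth_append rev_nth nth_Cons')
    then have meets: "meets (rev_onto (x # xr) []) (y # yr) \<longleftrightarrow> (\<exists>i\<le>m. ?xs ! i \<and> ?ys ! (m - i))"
      using Cons.prems(1,2) by (auto simp: rev_onto meets_iff less_Suc_eq_le)
    show ?thesis
    proof (cases "meets (rev_onto (x # xr) []) (y # yr)")
      case True
      have cov: "\<exists>i\<le>k. ?xs ! i \<and> ?ys ! (k - i)" if "k < Suc m" for k
      proof (cases "k = m")
        case True
        then show ?thesis using meets \<open>meets _ _\<close> by simp
      next
        case False
        then have "k < m" using that by simp
        then obtain i where "i \<le> k" "rev xr ! i" "rev yr ! (k - i)"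
          using Cons.prems(5) by (elim allE[of _ k] impE exE conjE)
        then show ?thesis using Cons.prems(1,2) \<open>k < m\<close> by (intro exI[of _ i]) (simp add: nth_append less_imp_diff_less)
      qed
      have "bounds (card (bad (rev (x # xr)) (rev (y # yr)))) (search fs (x # xr) (y # yr))"
      proof (rule Cons.IH[OF _ _ _ fs(2)])
        show "length (x # xr) = Suc m" "length (y # yr) = Suc m" "Suc m + length fs = 9"
          using Cons.prems(1,2,3) by simp_all
        show "\<forall>k<Suc m. \<exists>i\<le>k. rev (x # xr) ! i \<and> rev (y # yr) ! (k - i)"
          using cov by simp
      qed
      then show ?thesis using True by simp
    next
      case False
      have "extensions ?xs ?ys \<subseteq> uncovered m"
      proof (rule subrelI)
        fix A B assume AB: "(A, B) \<in> extensions ?xs ?ys"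
        have "\<not> (i \<in> A \<and> m - i \<in> B)" if "i \<le> m" for i
        proof -
          have "i \<in> A \<longleftrightarrow> ?xs ! i" "m - i \<in> B \<longleftrightarrow> ?ys ! (m - i)"
            using AB that Cons.prems(1,2) by (auto simp: extensions_def)
          then show ?thesis using False meets that by blast
        qed
        then show "(A, B) \<in> uncovered m" by (simp add: uncovered_def)
      qed
      then have "bad ?xs ?ys = extensions ?xs ?ys" using m unfolding bad_def by fastforce
      then show ?thesis
        using card_extensions[of ?xs "Suc m" ?ys] Cons.prems(1,2) m fs(1) False by (simp add: bounds_def)
    qed
  qed
  show ?case
    unfolding search.simps Let_def card_bad_split[of "rev xr" "rev yr"] by (intro bounds_add go)
qed


subsection \<open>Evaluation at 17\<close>

text \<open>The powers \<open>4 ^ 15\<close> down to \<open>4 ^ 9\<close>, the numbers of extensions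
  of prefix pairs of lengths 3 to 9.\<close>

definition search_weights :: "int list" where
  "search_weights = [1073741824, 268435456, 67108864, 16777216, 4194304, 1048576, 262144]"

text \<open>The search starts at length 2, and \<open>b \<or> c\<close> says that position
  \<open>1\<close> is covered.\<close>

lemma search_bounds_2:
  assumes "b \<or> c"
  shows "bounds (card (bad [True, b] [True, c])) (search search_weights [b, True] [c, True])"
proof -
  have "search_weights = map (\<lambda>i. 4 ^ (17 - i)) [2..<9]"
    by (simp add: search_weights_def upt_conv_Cons)
  moreover have "\<exists>i\<le>k. rev [b, True] ! i \<and> rev [c, True] ! (k - i)" if "k < 2" for k
  proof (cases "k = 0")
    case False
    then have "k = 1" using that by simp
    then show ?thesis using assms by (cases b) (auto intro: exI[of _ 0] exI[of _ 1])
  qed simp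
  moreover have "length search_weights = 7" by (simp add: search_weights_def)
  ultimately show ?thesis
    using search_bounds[of "[b, True]" 2 "[c, True]" search_weights] by simp
qed

lemma search_False_True:
  "search search_weights [False, True] [True, True] = (1873010453, 1885118130)"
  unfolding search_weights_def by code_simp

lemma search_True_True:
  "search search_weights [True, True] [True, True] = (730092126, 742663429)"
  unfolding search_weights_def by code_simp

text \<open>Split by the bits at \<open>1\<close>. If both are absent, \<open>1\<close> is uncovered
  and all \<open>4 ^ 16 = 4294967296\<close> extensions are bad; the two mixed cases agree by
  symmetry.\<close>

lemma card_bad_bounds:
  "8771080328 \<le> card (bad [True] [True])" "card (bad [True] [True]) \<le> 8807866985"
proof -
  have "extensions [True, False] [True, False] \<subseteq> uncovered 1"
  proof (rule subrelI)
    fix A B assume "(A, B) \<in> extensions [True, False] [True, False]"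
    then have "1 \<notin> A" "1 \<notin> B" by (auto simp: extensions_def)
    then have "\<not> (i \<in> A \<and> 1 - i \<in> B)" if "i \<le> 1" for i
      using that by (cases "i = 0") (auto simp: le_Suc_eq)
    then show "(A, B) \<in> uncovered 1" by (simp add: uncovered_def)
  qed
  then have "bad [True, False] [True, False] = extensions [True, False] [True, False]"
    unfolding bad_def by fastforce
  then have "card (bad [True, False] [True, False]) = 4294967296"
    using card_extensions[of "[True, False]" 2 "[True, False]"] by simp
  then have "card (bad [True] [True]) = 4294967296 + 2 * card (bad [True, False] [True, True])
      + card (bad [True, True] [True, True])"
    using card_bad_split[of "[True]" "[True]"] card_bad_swap[of "[True, True]" "[True, False]"] by simp
  moreover have "bounds (card (bad [True, False] [True, True])) (1873010453, 1885118130)"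
    using search_bounds_2[of False True] by (simp add: search_False_True)
  moreover have "bounds (card (bad [True, True] [True, True])) (730092126, 742663429)"
    using search_bounds_2[of True True] by (simp add: search_True_True)
  ultimately show "8771080328 \<le> card (bad [True] [True])" "card (bad [True] [True]) \<le> 8807866985"
    by (auto simp: bounds_def)
qed

lemma covering_ratio_17: "0.48731 \<le> covering_ratio 17" "covering_ratio 17 \<le> 0.489457"
proof -
  have "covering_pairs 17 = extensions [True] [True] - bad [True] [True]"
  proof (rule set_eqI, clarify)
    fix A B
    show "(A, B) \<in> covering_pairs 17 \<longleftrightarrow> (A, B) \<in> extensions [True] [True] - bad [True] [True]"
      unfolding covering_pairs_def bad_def extensions_def uncovered_def by simp blast
  qed
  moreover have "bad [True] [True] \<subseteq> extensions [True] [True]" by (auto simp: bad_def)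
  \<comment> \<open>There are \<open>4 ^ 17 = 17179869184\<close> pairs in all, the two zeros being
    fixed.\<close>
  ultimately have "card (covering_pairs 17) = 17179869184 - card (bad [True] [True])"
    using card_extensions[of "[True]" 1 "[True]"] by (simp add: card_Diff_subset)
  then have "8372002199 \<le> card (covering_pairs 17)" "card (covering_pairs 17) \<le> 8408788856"
    using card_bad_bounds by auto
  then have "8372002199 \<le> real (card (covering_pairs 17))" "real (card (covering_pairs 17)) \<le> 8408788856"
    by linarith+
  then show "0.48731 \<le> covering_ratio 17" "covering_ratio 17 \<le> 0.489457"
    by (simp_all add: covering_ratio_def)
qed

section \<open>Transfer of monotonicity and limit to the numerical sets\<close>

theorem mainTheorem1:
  shows "(\<forall>g\<ge>1. card (numerical_sets_with_frobenius g) = 2 ^ (g - 1)) \<and>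
         antimono_on {1..} gamma_ratio \<and>
         (\<exists>gamma_inf::real. gamma_ratio \<longlonglongrightarrow> gamma_inf \<and>
            \<bar>gamma_inf - 0.484451\<bar> \<le> 0.005011)"
proof (intro conjI)
  show "\<forall>g\<ge>1. card (numerical_sets_with_frobenius g) = 2 ^ (g - 1)"
    using card_numerical_sets_with_frobenius by blast
  show "antimono_on {1..} gamma_ratio"
  proof (rule monotone_onI)
    fix g g' :: nat assume g: "g \<in> {1..}" "g' \<in> {1..}" "g \<le> g'"
    then have "(g - 1) div 2 \<le> (g' - 1) div 2" by (simp add: div_le_mono)
    then show "gamma_ratio g' \<le> gamma_ratio g"
      using g decseqD[OF decseq_covering_ratio] by (simp add: gamma_ratio_eq_covering_ratio)
  qed
  obtain L where L: "covering_ratio \<longlonglongrightarrow> L"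
    "covering_ratio 17 - (3/4) ^ 17 \<le> L" "L \<le> covering_ratio 17"
    by (rule covering_ratio_limit_bounds)
  have "filterlim (\<lambda>g. (g - 1) div 2) at_top (sequentially :: nat filter)"
    unfolding filterlim_at_top
  proof (intro allI eventually_sequentiallyI)
    fix Z g :: nat assume "2 * Z + 1 \<le> g"
    then show "Z \<le> (g - 1) div 2" by linarith
  qed
  then have "(\<lambda>g. covering_ratio ((g - 1) div 2)) \<longlonglongrightarrow> L"
    by (rule filterlim_compose[OF L(1)])
  \<comment> \<open>Equality holds only from \<open>g = 1\<close> on: at \<open>g = 0\<close> the
    left side is \<open>0\<close> and the right side is \<open>1\<close>.\<close>
  moreover have "\<forall>\<^sub>F g in sequentially. gamma_ratio g = covering_ratio ((g - 1) div 2)"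
    using eventually_ge_at_top[of "1 :: nat"] by eventually_elim (rule gamma_ratio_eq_covering_ratio)
  ultimately have "gamma_ratio \<longlonglongrightarrow> L"
    by (simp add: tendsto_cong)
  \<comment> \<open>Hence \<open>L\<close> lies between \<open>0.48731 - 0.00752 = 0.47979\<close>
    and \<open>0.489457\<close>, inside the claimed interval from \<open>0.47944\<close> to
    \<open>0.489462\<close>.\<close>
  moreover have "(3/4 :: real) ^ 17 \<le> 0.00752" by (simp add: power_divide)
  then have "\<bar>L - 0.484451\<bar> \<le> 0.005011"
    using L(2,3) covering_ratio_17 unfolding abs_le_iff by auto
  ultimately show "\<exists>gamma_inf::real. gamma_ratio \<longlonglongrightarrow> gamma_inf \<and>
      \<bar>gamma_inf - 0.484451\<bar> \<le> 0.005011"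
    by blast
qed

end
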